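(* Let $(\gamma,\nu):(I,t_0)\to\mathbb{R}^2\times S^1$ be a Legendre curve of the form $\gamma(t)=(x(t),z(t))$, $\nu(t)=(\cos\varphi(t),\sin\varphi(t))$ with curvature $(\dot\varphi,\beta)$. Let $J(t)=-\beta(t)x(t)$ and $H(t)=\frac12\bigl(x(t)\dot\varphi(t)+\beta(t)\cos\varphi(t)\bigr)$. (1) Suppose that $x(t_0)>0$ and that the smooth function $J:(I,t_0)\to\mathbb{R}$ is given. Then, around $t_0$, $\gamma$ is given by $$x(t)=\Bigl(2\int J(t)\sin\varphi(t)\,dt\Bigr)^{1/2},\qquad z(t)=-\int\frac{J(t)}{x(t)}\cos\varphi(t)\,dt.$$ (2) Suppose that $\cos\varphi(t_0)\neq0$ and that the smooth function $H:(I,t_0)\to\mathbb{R}$ is given. Then, around $t_0$, $\gamma$ is given by $$x(t)=\frac{1}{\cos\varphi(t)}\Bigl(-\int2H(t)\sin\varphi(t)\,dt\Bigr),\qquad z(t)=\int\bigl(2H(t)-\dot\varphi(t)x(t)\bigr)dt.$$ (In both parts, for suitable choices of the integration constants.)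
   Context: All maps are $C^\infty$; $(I,t_0)$ denotes an interval with base point $t_0\in I$ (the statement is local around $t_0$). A Legendre curve is a smooth map $(\gamma,\nu):I\to\mathbb{R}^2\times S^1$ with $\dot\gamma\cdot\nu=0$. With $\boldsymbol{\mu}=(-\sin\varphi,\cos\varphi)$ (the rotation of $\nu=(\cos\varphi,\sin\varphi)$ by $\pi/2$, where $\varphi$ is smooth), its curvature is $(\ell,\beta)=(\dot\nu\cdot\boldsymbol{\mu},\dot\gamma\cdot\boldsymbol{\mu})=(\dot\varphi,\beta)$, so $\dot x=-\beta\sin\varphi$, $\dot z=\beta\cos\varphi$. The functions $J$ and $H$ are the components $J^z_F$, $H^z_F$ of the curvature of the surface of revolution $(x(t)\cos\theta,x(t)\sin\theta,z(t))$ as a framed surface. Indefinite integrals denote antiderivatives. *)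

theory Defs
  imports "HOL-Analysis.Analysis"
begin

text \<open>
  Derivatives are taken within the parameter interval, hence are one-sided at an endpoint
  belonging to it.  \<open>D k\<close> below is the \<open>k\<close>-th derivative of \<open>f\<close>.
\<close>

definition smooth_curve_on :: "real set \<Rightarrow> (real \<Rightarrow> 'a::real_normed_vector) \<Rightarrow> bool" where
  "smooth_curve_on I f \<longleftrightarrow>
     (\<exists>D :: nat \<Rightarrow> real \<Rightarrow> 'a.
        (\<forall>t\<in>I. D 0 t = f t) \<and>
        (\<forall>k. \<forall>t\<in>I. (D k has_vector_derivative D (Suc k) t) (at t within I)))"

definition velocity :: "real set \<Rightarrow> (real \<Rightarrow> 'a::real_normed_vector) \<Rightarrow> real \<Rightarrow> 'a" where
  "velocity I f t = vector_derivative f (at t within I)"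

definition legendre_curve ::
  "real set \<Rightarrow> (real \<Rightarrow> real \<times> real) \<Rightarrow> (real \<Rightarrow> real \<times> real) \<Rightarrow> bool" where
  "legendre_curve I \<gamma> \<nu> \<longleftrightarrow>
     smooth_curve_on I \<gamma> \<and> smooth_curve_on I \<nu> \<and>
     (\<forall>t\<in>I. \<nu> t \<in> sphere 0 1) \<and>
     (\<forall>t\<in>I. velocity I \<gamma> t \<bullet> \<nu> t = 0)"

definition rotate_quarter :: "real \<times> real \<Rightarrow> real \<times> real" where
  "rotate_quarter v = (- snd v, fst v)"

definition legendre_curvature ::
  "real set \<Rightarrow> (real \<Rightarrow> real \<times> real) \<Rightarrow> (real \<Rightarrow> real \<times> real) \<Rightarrow> real \<Rightarrow> real \<times> real" where
  "legendre_curvature I \<gamma> \<nu> t =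
     (velocity I \<nu> t \<bullet> rotate_quarter (\<nu> t), velocity I \<gamma> t \<bullet> rotate_quarter (\<nu> t))"

definition antiderivative_on :: "real set \<Rightarrow> (real \<Rightarrow> real) \<Rightarrow> (real \<Rightarrow> real) \<Rightarrow> bool" where
  "antiderivative_on U f F \<longleftrightarrow> (\<forall>t\<in>U. (F has_real_derivative f t) (at t within U))"

end

theory Submission
  imports Defs
begin

text \<open>
  The frame \<open>(\<nu>, \<mu>)\<close> with \<open>\<nu> = (cos \<phi>, sin \<phi>)\<close> is orthonormal,
  so \<open>\<gamma>' \<bullet> \<nu> = 0\<close> and \<open>\<gamma>' \<bullet> \<mu> = \<beta>\<close> leave no choice but \<open>x' = - \<beta> sin \<phi>\<close> and
  \<open>z' = \<beta> cos \<phi>\<close> (\<open>legendre_structure_equations\<close>).  Both representation formulas then amount to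
  recognising an exact derivative:
  \<^item> \<open>(x\<^sup>2 / 2)' = x x' = J sin \<phi>\<close> since \<open>J = - \<beta> x\<close>, while \<open>- z' = - \<beta> cos \<phi> = (J / x) cos \<phi>\<close>
    wherever \<open>x \<noteq> 0\<close>;
  \<^item> \<open>(- x cos \<phi>)' = (\<beta> cos \<phi> + x \<phi>') sin \<phi> = 2 H sin \<phi>\<close>, while \<open>z' = \<beta> cos \<phi> = 2 H - \<phi>' x\<close>.
  The antiderivatives with the right integration constants are therefore \<open>x\<^sup>2 / 2\<close>, \<open>- z\<close>,
  \<open>- x cos \<phi>\<close> and \<open>z\<close> themselves.  Recovering \<open>x\<close> from the first and the
  third takes \<open>x > 0\<close> and \<open>cos \<phi> \<noteq> 0\<close> respectively; the two conditions persist near \<open>t0\<close> by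
  continuity.
\<close>

text \<open>
  Derivatives within a set are unique only at its limit points; connectedness makes every
  point of a nondegenerate interval one, endpoints included.
\<close>

lemma at_within_interval_nontrivial:
  fixes I :: "real set"
  assumes "is_interval I" and "interior I \<noteq> {}" and "t \<in> I"
  shows "at t within I \<noteq> bot"
proof -
  have "I \<noteq> {a}" for a
    using assms(2) by auto
  moreover have "connected I"
    using assms(1) by (simp add: is_interval_connected)
  ultimately have "t islimpt I"
    using assms(3) connected_imp_perfect by blast
  then show ?thesis
    by (simp add: trivial_limit_within)
qed

lemma smooth_curve_on_has_velocity:
  assumes "smooth_curve_on I f" and "t \<in> I" and "at t within I \<noteq> bot"
  shows "(f has_vector_derivative velocity I f t) (at t within I)"
proof -
  obtain D where D0: "\<And>s. s \<in> I \<Longrightarrow> D (0::nat) s = f s"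
    and D: "(D 0 has_vector_derivative D 1 t) (at t within I)"
    using assms(1,2) unfolding smooth_curve_on_def by (metis One_nat_def)
  have "(f has_vector_derivative D 1 t) (at t within I)"
    using has_vector_derivative_transform[OF assms(2) _ D] D0 by simp
  then show ?thesis
    using vector_derivative_within[OF assms(3)] unfolding velocity_def by metis
qed

text \<open>
  The two conditions form a linear system in the components of \<open>v\<close> whose matrix is a rotation, so
  its inverse is its transpose.
\<close>

lemma components_from_frame:
  fixes v :: "real \<times> real"
  assumes "v \<bullet> (cos p, sin p) = 0" and "v \<bullet> rotate_quarter (cos p, sin p) = b"
  shows "v = (- b * sin p, b * cos p)"
proof -
  obtain a c where v: "v = (a, c)" by (cases v)
  have n: "a * cos p + c * sin p = 0" and m: "c * cos p - a * sin p = b"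
    using assms by (simp_all add: v rotate_quarter_def)
  have u: "cos p * cos p + sin p * sin p = 1"
    using sin_cos_squared_add[of p] by (simp add: power2_eq_square add.commute)
  have "a = - b * sin p" "c = b * cos p"
    using n m u by algebra+
  then show ?thesis by (simp add: v)
qed

lemma legendre_structure_equations:
  fixes x z \<phi> \<beta> :: "real \<Rightarrow> real"
  assumes "legendre_curve I \<gamma> \<nu>" and "t \<in> I" and "at t within I \<noteq> bot"
    and \<gamma>: "\<And>s. s \<in> I \<Longrightarrow> \<gamma> s = (x s, z s)"
    and "\<nu> t = (cos (\<phi> t), sin (\<phi> t))"
    and "snd (legendre_curvature I \<gamma> \<nu> t) = \<beta> t"
  shows "(x has_real_derivative - \<beta> t * sin (\<phi> t)) (at t within I)"
    and "(z has_real_derivative \<beta> t * cos (\<phi> t)) (at t within I)"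
proof -
  have "velocity I \<gamma> t = (- \<beta> t * sin (\<phi> t), \<beta> t * cos (\<phi> t))"
    using assms(1,2,5,6)
    by (intro components_from_frame) (auto simp: legendre_curve_def legendre_curvature_def)
  then have d: "(\<gamma> has_vector_derivative (- \<beta> t * sin (\<phi> t), \<beta> t * cos (\<phi> t))) (at t within I)"
    using smooth_curve_on_has_velocity[of I \<gamma> t] assms(1-3) by (simp add: legendre_curve_def)
  have "((\<lambda>s. fst (\<gamma> s)) has_vector_derivative - \<beta> t * sin (\<phi> t)) (at t within I)"
    using bounded_linear.has_vector_derivative[OF bounded_linear_fst d] by simp
  then have "(x has_vector_derivative - \<beta> t * sin (\<phi> t)) (at t within I)"
    by (rule has_vector_derivative_transform[OF assms(2), rotated]) (simp add: \<gamma>)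
  then show "(x has_real_derivative - \<beta> t * sin (\<phi> t)) (at t within I)"
    by (simp add: has_real_derivative_iff_has_vector_derivative)
  have "((\<lambda>s. snd (\<gamma> s)) has_vector_derivative \<beta> t * cos (\<phi> t)) (at t within I)"
    using bounded_linear.has_vector_derivative[OF bounded_linear_snd d] by simp
  then have "(z has_vector_derivative \<beta> t * cos (\<phi> t)) (at t within I)"
    by (rule has_vector_derivative_transform[OF assms(2), rotated]) (simp add: \<gamma>)
  then show "(z has_real_derivative \<beta> t * cos (\<phi> t)) (at t within I)"
    by (simp add: has_real_derivative_iff_has_vector_derivative)
qed

lemma continuous_within_stays_in_open:
  fixes f :: "'a::metric_space \<Rightarrow> 'b::topological_space"
  assumes "continuous (at a within S) f" and "open U" and "f a \<in> U"
  shows "\<exists>e>0. \<forall>t\<in>S \<inter> ball a e. f t \<in> U"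
proof -
  have "\<forall>\<^sub>F t in at a within S. f t \<in> U"
    using assms by (auto simp: continuous_within intro: topological_tendstoD)
  then obtain e where "e > 0" and e: "\<forall>t\<in>S. t \<noteq> a \<and> dist t a < e \<longrightarrow> f t \<in> U"
    by (auto simp: eventually_at)
  then show ?thesis
    using assms(3) by (intro exI[of _ e]) (auto simp: dist_commute)
qed

theorem theorem3p11:
  fixes I :: "real set" and t0 :: real
    and \<gamma> \<nu> :: "real \<Rightarrow> real \<times> real"
    and x z \<phi> \<beta> J H :: "real \<Rightarrow> real"
  assumes "is_interval I" and "interior I \<noteq> {}" and "t0 \<in> I"
    and "legendre_curve I \<gamma> \<nu>"
    and "smooth_curve_on I \<phi>"
    and "\<And>t. t \<in> I \<Longrightarrow> \<gamma> t = (x t, z t)"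
    and "\<And>t. t \<in> I \<Longrightarrow> \<nu> t = (cos (\<phi> t), sin (\<phi> t))"
    and "\<And>t. t \<in> I \<Longrightarrow> legendre_curvature I \<gamma> \<nu> t = (velocity I \<phi> t, \<beta> t)"
    and "\<And>t. t \<in> I \<Longrightarrow> J t = - \<beta> t * x t"
    and "\<And>t. t \<in> I \<Longrightarrow> H t = 1 / 2 * (x t * velocity I \<phi> t + \<beta> t * cos (\<phi> t))"
  shows
    "(x t0 > 0 \<and> smooth_curve_on I J \<longrightarrow>
       (\<exists>e>0. \<exists>F G.
          antiderivative_on (I \<inter> ball t0 e) (\<lambda>t. J t * sin (\<phi> t)) F \<and>
          antiderivative_on (I \<inter> ball t0 e) (\<lambda>t. J t / x t * cos (\<phi> t)) G \<and>
          (\<forall>t \<in> I \<inter> ball t0 e. F t > 0 \<and> x t = sqrt (2 * F t) \<and> z t = - G t)))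
     \<and>
     (cos (\<phi> t0) \<noteq> 0 \<and> smooth_curve_on I H \<longrightarrow>
       (\<exists>e>0. \<exists>F G.
          antiderivative_on (I \<inter> ball t0 e) (\<lambda>t. 2 * H t * sin (\<phi> t)) F \<and>
          antiderivative_on (I \<inter> ball t0 e) (\<lambda>t. 2 * H t - velocity I \<phi> t * x t) G \<and>
          (\<forall>t \<in> I \<inter> ball t0 e.
             cos (\<phi> t) \<noteq> 0 \<and> x t = 1 / cos (\<phi> t) * (- F t) \<and> z t = G t)))"
proof -
  have nontriv: "at t within I \<noteq> bot" if "t \<in> I" for t
    using at_within_interval_nontrivial assms(1,2) that by blast
  have dx: "(x has_real_derivative - \<beta> t * sin (\<phi> t)) (at t within I)"
    and dz: "(z has_real_derivative \<beta> t * cos (\<phi> t)) (at t within I)" if "t \<in> I" for t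
    using legendre_structure_equations[where \<gamma> = \<gamma> and \<nu> = \<nu> and x = x and z = z and \<phi> = \<phi> and \<beta> = \<beta>
        and I = I and t = t] assms(4,6-8) nontriv that by simp_all
  have d\<phi>: "(\<phi> has_real_derivative velocity I \<phi> t) (at t within I)" if "t \<in> I" for t
    using smooth_curve_on_has_velocity[OF assms(5) that nontriv[OF that]]
    by (simp add: has_real_derivative_iff_has_vector_derivative)

  have part1: "\<exists>e>0. \<exists>F G.
          antiderivative_on (I \<inter> ball t0 e) (\<lambda>t. J t * sin (\<phi> t)) F \<and>
          antiderivative_on (I \<inter> ball t0 e) (\<lambda>t. J t / x t * cos (\<phi> t)) G \<and>
          (\<forall>t \<in> I \<inter> ball t0 e. F t > 0 \<and> x t = sqrt (2 * F t) \<and> z t = - G t)"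
    if x0: "x t0 > 0"
  proof -
    have "continuous (at t0 within I) x"
      using dx[OF assms(3)] by (rule DERIV_continuous)
    then obtain e where "e > 0" and "\<forall>t\<in>I \<inter> ball t0 e. x t \<in> {0<..}"
      using continuous_within_stays_in_open[of t0 I x "{0<..}"] x0 by auto
    then have pos: "x t > 0" if "t \<in> I \<inter> ball t0 e" for t
      using that by blast
    have "antiderivative_on (I \<inter> ball t0 e) (\<lambda>t. J t * sin (\<phi> t)) (\<lambda>t. (x t)\<^sup>2 / 2)"
      unfolding antiderivative_on_def
    proof
      fix t assume t: "t \<in> I \<inter> ball t0 e"
      have "((\<lambda>t. (x t)\<^sup>2 / 2) has_real_derivative J t * sin (\<phi> t)) (at t within I)"
        using t by (auto intro!: derivative_eq_intros dx simp: assms(9))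
      then show "((\<lambda>t. (x t)\<^sup>2 / 2) has_real_derivative J t * sin (\<phi> t))
          (at t within I \<inter> ball t0 e)"
        by (rule DERIV_subset) simp
    qed
    moreover have "antiderivative_on (I \<inter> ball t0 e) (\<lambda>t. J t / x t * cos (\<phi> t)) (\<lambda>t. - z t)"
      unfolding antiderivative_on_def
    proof
      fix t assume t: "t \<in> I \<inter> ball t0 e"
      have "((\<lambda>t. - z t) has_real_derivative J t / x t * cos (\<phi> t)) (at t within I)"
        using t pos[OF t] by (auto intro!: derivative_eq_intros dz simp: assms(9))
      then show "((\<lambda>t. - z t) has_real_derivative J t / x t * cos (\<phi> t))
          (at t within I \<inter> ball t0 e)"
        by (rule DERIV_subset) simp
    qed
    moreover have "(x t)\<^sup>2 / 2 > 0 \<and> x t = sqrt (2 * ((x t)\<^sup>2 / 2)) \<and> z t = - (- z t)"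
      if "t \<in> I \<inter> ball t0 e" for t
      using pos[OF that] by simp
    ultimately show ?thesis
      using \<open>e > 0\<close> by blast
  qed

  have part2: "\<exists>e>0. \<exists>F G.
          antiderivative_on (I \<inter> ball t0 e) (\<lambda>t. 2 * H t * sin (\<phi> t)) F \<and>
          antiderivative_on (I \<inter> ball t0 e) (\<lambda>t. 2 * H t - velocity I \<phi> t * x t) G \<and>
          (\<forall>t \<in> I \<inter> ball t0 e.
             cos (\<phi> t) \<noteq> 0 \<and> x t = 1 / cos (\<phi> t) * (- F t) \<and> z t = G t)"
    if c0: "cos (\<phi> t0) \<noteq> 0"
  proof -
    have "continuous (at t0 within I) (\<lambda>t. cos (\<phi> t))"
      using DERIV_continuous[OF d\<phi>[OF assms(3)]] by (intro continuous_intros)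
    then obtain e where "e > 0" and "\<forall>t\<in>I \<inter> ball t0 e. cos (\<phi> t) \<in> - {0}"
      using continuous_within_stays_in_open[of t0 I "\<lambda>t. cos (\<phi> t)" "- {0}"] c0
      by (auto simp: open_Compl)
    then have nz: "cos (\<phi> t) \<noteq> 0" if "t \<in> I \<inter> ball t0 e" for t
      using that by blast
    have "antiderivative_on (I \<inter> ball t0 e) (\<lambda>t. 2 * H t * sin (\<phi> t)) (\<lambda>t. - (x t * cos (\<phi> t)))"
      unfolding antiderivative_on_def
    proof
      fix t assume t: "t \<in> I \<inter> ball t0 e"
      have "((\<lambda>t. - (x t * cos (\<phi> t))) has_real_derivative 2 * H t * sin (\<phi> t)) (at t within I)"
        using t by (auto intro!: derivative_eq_intros dx d\<phi> simp: assms(10) algebra_simps)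
      then show "((\<lambda>t. - (x t * cos (\<phi> t))) has_real_derivative 2 * H t * sin (\<phi> t))
          (at t within I \<inter> ball t0 e)"
        by (rule DERIV_subset) simp
    qed
    moreover have "antiderivative_on (I \<inter> ball t0 e) (\<lambda>t. 2 * H t - velocity I \<phi> t * x t) z"
      unfolding antiderivative_on_def
    proof
      fix t assume t: "t \<in> I \<inter> ball t0 e"
      have "2 * H t - velocity I \<phi> t * x t = \<beta> t * cos (\<phi> t)"
        using t by (simp add: assms(10) algebra_simps)
      then show "(z has_real_derivative 2 * H t - velocity I \<phi> t * x t)
          (at t within I \<inter> ball t0 e)"
        using DERIV_subset[OF dz[of t], of "I \<inter> ball t0 e"] t by simp
    qed
    moreover have "x t = 1 / cos (\<phi> t) * (- (- (x t * cos (\<phi> t))))"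
      if "t \<in> I \<inter> ball t0 e" for t
      using nz[OF that] by simp
    ultimately show ?thesis
      using \<open>e > 0\<close> nz by blast
  qed

  show ?thesis
    using part1 part2 by blast
qed

end
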